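(* Let $(\mathcal Y,\Sigma,P)$ be a probability space, let $\Phi:\mathcal Y\to\mathcal Y$ be a map, let $\mathcal G$ be a finite group with identity $e$, let $\mathcal O$ be a finite set, and let $\psi=(\psi_o)_{o\in\mathcal O}:\mathcal Y\to\mathbb C^{\mathcal O}$ be such that $\psi_o\in L^2_P(\mathcal Y)$ and $\psi_o\circ\Phi\in L^2_P(\mathcal Y)$ for all $o\in\mathcal O$. Assume: (A1) $\mathcal G$ acts on $\mathcal Y$ from the left, and $\mathcal G$ acts freely on $\mathcal O$ from the right (i.e. $o\cdot g=o$ for some $o\in\mathcal O$ implies $g=e$). (A2) $\psi_o(g\cdot y)=\psi_{o\cdot g}(y)$ for all $g\in\mathcal G$, $o\in\mathcal O$, $y\in\mathcal Y$. (A3) $\Phi(g\cdot y)=g\cdot\Phi(y)$ for all $g\in\mathcal G$, $y\in\mathcal Y$. (A4) For every $g\in\mathcal G$, if $\bm y$ is a $\mathcal Y$-valued random variable with distribution $P$, then $g\cdot\bm y$ also has distribution $P$ (equivalently, $P(g\cdot\mathcal A)=P(\mathcal A)$ for all $g\in\mathcal G$ and $\mathcal A\in\Sigma$). Then there exists an equivariant EDMD matrix, i.e. there is a matrix $K\in\mathbb C^{\mathcal O\times\mathcal O}$ that minimizes $$\ell(K)=\mathbb E\big[\lVert K\psi(\bm y)-\psi(\Phi(\bm y))\rVert^2\big],\qquad \bm y\sim P,$$ over all matrices in $\mathbb C^{\mathcal O\times\mathcal O}$, and that satisfies $K_{o,o'}=K_{o\cdot g,\,o'\cdot g}$ for all $o,o'\in\mathcal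 O$ and $g\in\mathcal G$.
   Context: Matrices in $\mathbb C^{\mathcal O\times\mathcal O}$ are indexed by the finite set $\mathcal O$, with $(Ku)_o=\sum_{o'\in\mathcal O}K_{o,o'}u_{o'}$ for $u\in\mathbb C^{\mathcal O}$, and $\lVert\cdot\rVert$ is the Euclidean norm on $\mathbb C^{\mathcal O}$. The functions $\psi_o$ are genuine (everywhere defined) measurable functions $\mathcal Y\to\mathbb C$ that are square-integrable with respect to $P$. The Koopman operator of $\Phi$ acts on functions $f$ on $\mathcal Y$ by $f\mapsto f\circ\Phi$. An EDMD matrix is any minimizer over $\mathbb C^{\mathcal O\times\mathcal O}$ of $\ell(K)=\mathbb E[\lVert K\psi(\bm y)-(\psi\circ\Phi)(\bm y)\rVert^2]$ with $\bm y\sim P$ (it need not be unique). A matrix $K\in\mathbb C^{\mathcal O\times\mathcal O}$ is called equivariant if $K_{o,o'}=K_{o\cdot g,o'\cdot g}$ for all $g\in\mathcal G$, $o,o'\in\mathcal O$. A left action satisfies $e\cdot y=y$ and $(gh)\cdot y=g\cdot(h\cdot y)$; a right action satisfies $o\cdot e=o$ and $o\cdot(gh)=(o\cdot g)\cdot h$. For each $g\in\mathcal G$ the map $y\mapsto g\cdot y$ is $\Sigma$-measurable (implicit in (A4)), so (A4) says that $P$ is invariant under each of these maps. *)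

theory Defs
  imports "HOL-Probability.Probability" "HOL-Algebra.Group_Action"
begin

text \<open>
  The left action on the state space is the library's \<^locale>\<open>group_action\<close>, whose maps
  \<open>\<phi> g\<close> compose as \<open>\<phi> (g \<otimes> h) = \<phi> g \<circ> \<phi> h\<close> on the carrier. The library has no right actions;
  \<open>\<rho> a g\<close> below stands for \<open>a \<cdot> g\<close>.
\<close>

definition right_action :: "('g, 'm) monoid_scheme \<Rightarrow> 'o set \<Rightarrow> ('o \<Rightarrow> 'g \<Rightarrow> 'o) \<Rightarrow> bool" where
  "right_action G X \<rho> \<longleftrightarrow>
     (\<forall>a\<in>X. \<forall>g\<in>carrier G. \<rho> a g \<in> X) \<and>
     (\<forall>a\<in>X. \<rho> a \<one>\<^bsub>G\<^esub> = a) \<and>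
     (\<forall>a\<in>X. \<forall>g\<in>carrier G. \<forall>h\<in>carrier G. \<rho> a (g \<otimes>\<^bsub>G\<^esub> h) = \<rho> (\<rho> a g) h)"

definition free_right_action :: "('g, 'm) monoid_scheme \<Rightarrow> 'o set \<Rightarrow> ('o \<Rightarrow> 'g \<Rightarrow> 'o) \<Rightarrow> bool" where
  "free_right_action G X \<rho> \<longleftrightarrow>
     right_action G X \<rho> \<and> (\<forall>a\<in>X. \<forall>g\<in>carrier G. \<rho> a g = a \<longrightarrow> g = \<one>\<^bsub>G\<^esub>)"

text \<open>Genuine square-integrable functions, not almost-everywhere classes.\<close>

definition square_integrable :: "'y measure \<Rightarrow> ('y \<Rightarrow> complex) \<Rightarrow> bool" where
  "square_integrable M f \<longleftrightarrow> f \<in> borel_measurable M \<and> integrable M (\<lambda>y. (cmod (f y))\<^sup>2)"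

text \<open>
  Vectors and matrices indexed by a finite set \<open>X\<close>, possibly empty, are functions of type
  \<^typ>\<open>'o \<Rightarrow> complex\<close> and \<^typ>\<open>'o \<Rightarrow> 'o \<Rightarrow> complex\<close>. Only their entries with indices in \<open>X\<close> are
  ever used.
\<close>

definition mat_vec :: "'o set \<Rightarrow> ('o \<Rightarrow> 'o \<Rightarrow> complex) \<Rightarrow> ('o \<Rightarrow> complex) \<Rightarrow> 'o \<Rightarrow> complex" where
  "mat_vec X K u a = (\<Sum>b\<in>X. K a b * u b)"

definition vec_norm :: "'o set \<Rightarrow> ('o \<Rightarrow> complex) \<Rightarrow> real" where
  "vec_norm X u = L2_set (\<lambda>a. cmod (u a)) X"

definition edmd_loss ::
  "'y measure \<Rightarrow> ('y \<Rightarrow> 'y) \<Rightarrow> 'o set \<Rightarrow> ('y \<Rightarrow> 'o \<Rightarrow> complex) \<Rightarrow> ('o \<Rightarrow> 'o \<Rightarrow> complex) \<Rightarrow> real" where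
  "edmd_loss M \<Phi> X \<psi> K =
     (\<integral>y. (vec_norm X (\<lambda>a. mat_vec X K (\<psi> y) a - \<psi> (\<Phi> y) a))\<^sup>2 \<partial>M)"

definition edmd_matrix ::
  "'y measure \<Rightarrow> ('y \<Rightarrow> 'y) \<Rightarrow> 'o set \<Rightarrow> ('y \<Rightarrow> 'o \<Rightarrow> complex) \<Rightarrow> ('o \<Rightarrow> 'o \<Rightarrow> complex) \<Rightarrow> bool" where
  "edmd_matrix M \<Phi> X \<psi> K \<longleftrightarrow> is_arg_min (edmd_loss M \<Phi> X \<psi>) (\<lambda>_. True) K"

definition equivariant_matrix ::
  "('g, 'm) monoid_scheme \<Rightarrow> 'o set \<Rightarrow> ('o \<Rightarrow> 'g \<Rightarrow> 'o) \<Rightarrow> ('o \<Rightarrow> 'o \<Rightarrow> complex) \<Rightarrow> bool" where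
  "equivariant_matrix G X \<rho> K \<longleftrightarrow>
     (\<forall>g\<in>carrier G. \<forall>a\<in>X. \<forall>b\<in>X. K a b = K (\<rho> a g) (\<rho> b g))"

end

theory Submission
  imports Defs
begin

text \<open>
  A matrix is an EDMD matrix as soon as it solves the normal equations, that is, as soon as every
  row of \<open>K \<psi> - \<psi> \<circ> \<Phi>\<close> is orthogonal in \<open>L\<^sup>2(P)\<close> to every \<open>\<psi>\<^sub>c\<close>. These equations are affine in \<open>K\<close>,
  they always have a solution (Gram--Schmidt), and by invariance of \<open>P\<close> their solution set is stable
  under \<open>K \<mapsto> (K\<^bsub>a g, b g\<^esub>)\<close>. Hence the average of a solution over the group is an equivariant solution.
\<close>

section \<open>Inner product of square-integrable functions\<close>

definition l2_inner :: "'y measure \<Rightarrow> ('y \<Rightarrow> complex) \<Rightarrow> ('y \<Rightarrow> complex) \<Rightarrow> complex" where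
  "l2_inner M f g = (\<integral>y. f y * cnj (g y) \<partial>M)"

lemma square_integrable_mult_cnj:
  assumes "square_integrable M f" "square_integrable M g"
  shows "integrable M (\<lambda>y. f y * cnj (g y))"
proof (rule Bochner_Integration.integrable_bound)
  show "integrable M (\<lambda>y. (cmod (f y))\<^sup>2 + (cmod (g y))\<^sup>2)"
    using assms by (auto simp: square_integrable_def)
  have [measurable]: "f \<in> borel_measurable M" "g \<in> borel_measurable M"
    using assms by (auto simp: square_integrable_def)
  have [measurable]: "(\<lambda>y. cnj (g y)) \<in> borel_measurable M"
    by (intro borel_measurable_continuous_on[where f = cnj] continuous_intros) auto
  show "(\<lambda>y. f y * cnj (g y)) \<in> borel_measurable M"
    by measurable
  \<comment> \<open>The AM-GM bound \<open>2 * x * y \<le> x^2 + y^2\<close>, weakened by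
    \<open>0 \<le> x * y\<close>, supplies the integrable majorant.\<close>
  have "cmod (f y) * cmod (g y) \<le> (cmod (f y))\<^sup>2 + (cmod (g y))\<^sup>2" for y
    using sum_squares_bound[of "cmod (f y)" "cmod (g y)"]
      mult_nonneg_nonneg[OF norm_ge_zero norm_ge_zero, of "f y" "g y"] by linarith
  then show "AE y in M. norm (f y * cnj (g y)) \<le> norm ((cmod (f y))\<^sup>2 + (cmod (g y))\<^sup>2)"
    by (simp add: norm_mult)
qed

lemma square_integrable_cmult:
  assumes "square_integrable M f"
  shows "square_integrable M (\<lambda>y. c * f y)"
  using assms by (auto simp: square_integrable_def norm_mult power_mult_distrib)

text \<open>In the expansion of the squared modulus the only new term is the cross term. It is kept
  as the real part of a product so that \<open>square_integrable_mult_cnj\<close> applies to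
  it.\<close>

lemma square_integrable_add:
  assumes "square_integrable M f" "square_integrable M g"
  shows "square_integrable M (\<lambda>y. f y + g y)"
proof -
  have "(cmod (f y + g y))\<^sup>2 = (cmod (f y))\<^sup>2 + (cmod (g y))\<^sup>2 + 2 * Re (f y * cnj (g y))" for y
    unfolding cmod_power2 by (simp add: power2_eq_square algebra_simps)
  moreover have "integrable M (\<lambda>y. Re (f y * cnj (g y)))"
    by (intro integrable_Re square_integrable_mult_cnj assms)
  ultimately show ?thesis
    using assms by (auto simp: square_integrable_def simp del: times_complex.sel)
qed

lemma square_integrable_diff:
  assumes "square_integrable M f" "square_integrable M g"
  shows "square_integrable M (\<lambda>y. f y - g y)"
  using square_integrable_add[OF assms(1) square_integrable_cmult[OF assms(2), of "-1"]] by simp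

lemma square_integrable_sum:
  assumes "finite X" "\<And>b. b \<in> X \<Longrightarrow> square_integrable M (u b)"
  shows "square_integrable M (\<lambda>y. \<Sum>b\<in>X. k b * u b y)"
  using assms
proof (induction X rule: finite_induct)
  case empty
  then show ?case by (simp add: square_integrable_def)
next
  case (insert x X)
  then show ?case by (simp add: square_integrable_add square_integrable_cmult)
qed

lemma l2_inner_diff_left:
  assumes "square_integrable M f" "square_integrable M g" "square_integrable M h"
  shows "l2_inner M (\<lambda>y. f y - g y) h = l2_inner M f h - l2_inner M g h"
  using assms by (simp add: l2_inner_def left_diff_distrib square_integrable_mult_cnj)

text \<open>True for arbitrary functions: a nonzero factor does not change integrability,
  non-integrable functions have integral 0 by convention, and for \<open>c = 0\<close> both sides
  vanish.\<close>

lemma l2_inner_cmult_left: "l2_inner M (\<lambda>y. c * f y) h = c * l2_inner M f h"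
  by (simp add: l2_inner_def mult.assoc)

lemma l2_inner_sum_left:
  assumes "\<And>b. b \<in> X \<Longrightarrow> square_integrable M (u b)" "square_integrable M h"
  shows "l2_inner M (\<lambda>y. \<Sum>b\<in>X. k b * u b y) h = (\<Sum>b\<in>X. k b * l2_inner M (u b) h)"
  using assms
  by (simp add: l2_inner_def sum_distrib_right mult.assoc square_integrable_mult_cnj)

lemma cnj_l2_inner: "cnj (l2_inner M f g) = l2_inner M g f"
  by (simp add: l2_inner_def mult.commute flip: Bochner_Integration.integral_cnj)

section \<open>Orthogonality and projection onto a finite span\<close>

lemma l2_inner_sum_right_eq_0:
  assumes "\<And>b. b \<in> X \<Longrightarrow> square_integrable M (u b)" "square_integrable M f"
    and "\<And>b. b \<in> X \<Longrightarrow> l2_inner M f (u b) = 0"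
  shows "l2_inner M f (\<lambda>y. \<Sum>b\<in>X. k b * u b y) = 0"
proof -
  \<comment> \<open>Conjugate symmetry moves the sum to the first argument, where the form is
    linear.\<close>
  have "l2_inner M (u b) f = 0" if "b \<in> X" for b
    using assms(3)[OF that] cnj_l2_inner[of M f "u b"] by simp
  then have "l2_inner M (\<lambda>y. \<Sum>b\<in>X. k b * u b y) f = 0"
    using assms by (simp add: l2_inner_sum_left)
  then show ?thesis
    using cnj_l2_inner[of M "\<lambda>y. \<Sum>b\<in>X. k b * u b y" f] by simp
qed

text \<open>On genuine functions the form is only positive semidefinite: a null vector
  \<open>s\<close> vanishes almost everywhere, and hence so does its product with any
  \<open>r\<close>. This settles the degenerate Gram-Schmidt step below.\<close>

lemma l2_inner_self_eq_0D:
  assumes s: "square_integrable M s" and "l2_inner M s s = 0"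
  shows "l2_inner M r s = 0"
proof -
  have "l2_inner M s s = complex_of_real (\<integral>y. (cmod (s y))\<^sup>2 \<partial>M)"
    unfolding l2_inner_def complex_norm_square[symmetric] by (simp del: of_real_power flip: of_real_power)
  then have "(\<integral>y. (cmod (s y))\<^sup>2 \<partial>M) = 0"
    using assms by simp
  then have ae: "AE y in M. s y = 0"
    using s by (simp add: square_integrable_def integral_nonneg_eq_0_iff_AE)
  then have "AE y in M. r y * cnj (s y) = 0"
    by eventually_elim simp
  then show ?thesis
    unfolding l2_inner_def by (rule integral_eq_zero_AE)
qed

text \<open>Gram-Schmidt by induction on the index set. The function \<open>f\<close> stays
  arbitrary because the induction hypothesis is applied twice: to \<open>f\<close> and to the new
  vector \<open>u x\<close>. The family \<open>u\<close> may be linearly dependent.\<close>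

lemma l2_projection_exists:
  assumes "finite X" "\<And>b. b \<in> X \<Longrightarrow> square_integrable M (u b)" "square_integrable M f"
  shows "\<exists>k. \<forall>c\<in>X. l2_inner M (\<lambda>y. (\<Sum>b\<in>X. k b * u b y) - f y) (u c) = 0"
  using assms
proof (induction X arbitrary: f rule: finite_induct)
  case empty
  then show ?case by simp
next
  case (insert x X)
  have u: "square_integrable M (u b)" if "b \<in> insert x X" for b
    using insert.prems that by blast
  obtain kr where kr: "\<And>c. c \<in> X \<Longrightarrow> l2_inner M (\<lambda>y. (\<Sum>b\<in>X. kr b * u b y) - f y) (u c) = 0"
    using insert.IH[of f] insert.prems by auto
  obtain ks where ks: "\<And>c. c \<in> X \<Longrightarrow> l2_inner M (\<lambda>y. (\<Sum>b\<in>X. ks b * u b y) - u x y) (u c) = 0"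
    using insert.IH[of "u x"] insert.prems by auto
  \<comment> \<open>Both residuals are orthogonal to the old vectors; \<open>- s\<close> is the
    component of \<open>u x\<close> orthogonal to their span.\<close>
  define r where "r = (\<lambda>y. (\<Sum>b\<in>X. kr b * u b y) - f y)"
  define s where "s = (\<lambda>y. (\<Sum>b\<in>X. ks b * u b y) - u x y)"
  have r: "square_integrable M r" and s: "square_integrable M s"
    unfolding r_def s_def using insert.hyps insert.prems
    by (auto intro!: square_integrable_diff square_integrable_sum)
  \<comment> \<open>Writing \<open>u x\<close> as an old combination minus \<open>s\<close>, a
    vector \<open>v\<close> orthogonal to the old vectors sees only the part
    \<open>- s\<close>.\<close>
  have ux: "l2_inner M v (u x) = - l2_inner M v s"
    if v: "square_integrable M v" and "\<And>c. c \<in> X \<Longrightarrow> l2_inner M v (u c) = 0" for v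
  proof -
    have su: "square_integrable M (\<lambda>y. \<Sum>b\<in>X. ks b * u b y)"
      using insert.hyps u by (auto intro: square_integrable_sum)
    have "l2_inner M s v = l2_inner M (\<lambda>y. \<Sum>b\<in>X. ks b * u b y) v - l2_inner M (u x) v"
      unfolding s_def using su u v by (simp add: l2_inner_diff_left)
    then have "l2_inner M v s = l2_inner M v (\<lambda>y. \<Sum>b\<in>X. ks b * u b y) - l2_inner M v (u x)"
      by (metis cnj_l2_inner complex_cnj_diff)
    moreover have "l2_inner M v (\<lambda>y. \<Sum>b\<in>X. ks b * u b y) = 0"
      using that u by (intro l2_inner_sum_right_eq_0) auto
    ultimately show ?thesis by simp
  qed
  \<comment> \<open>This choice makes \<open>r - t * s\<close> orthogonal to \<open>s\<close>. If
    \<open>l2_inner M s s = 0\<close>, division by zero gives \<open>t = 0\<close>, which is still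
    correct because then \<open>l2_inner M r s = 0\<close>.\<close>
  define t where "t = l2_inner M r s / l2_inner M s s"
  \<comment> \<open>These are the coefficients of \<open>r - t * s\<close>: since \<open>s\<close>
    contains \<open>- u x\<close>, the coefficient of \<open>u x\<close> is
    \<open>+ t\<close>.\<close>
  define k where "k = (\<lambda>b. if b = x then t else kr b - t * ks b)"
  have res: "(\<Sum>b\<in>insert x X. k b * u b y) - f y = r y - t * s y" for y
  proof -
    have "(\<Sum>b\<in>X. k b * u b y) = (\<Sum>b\<in>X. kr b * u b y - t * (ks b * u b y))"
      using insert.hyps by (intro sum.cong) (auto simp: k_def algebra_simps)
    then show ?thesis
      using insert.hyps
      by (simp add: r_def s_def sum_subtractf sum_distrib_left k_def[THEN fun_cong, of x] algebra_simps)
  qed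
  have split: "l2_inner M (\<lambda>y. r y - t * s y) (u c) = l2_inner M r (u c) - t * l2_inner M s (u c)"
    if "c \<in> insert x X" for c
    using r s u[OF that]
    by (simp add: l2_inner_diff_left square_integrable_cmult l2_inner_cmult_left)
  have "l2_inner M (\<lambda>y. r y - t * s y) (u c) = 0" if "c \<in> X" for c
    using split[of c] that kr ks by (simp add: r_def s_def)
  moreover have "l2_inner M (\<lambda>y. r y - t * s y) (u x) = 0"
  proof -
    have "l2_inner M r s = t * l2_inner M s s"
      using l2_inner_self_eq_0D[OF s, of r] by (auto simp: t_def)
    then show ?thesis
      using split[of x] ux[OF r] ux[OF s] kr ks by (simp add: r_def s_def)
  qed
  ultimately show ?case
    unfolding res[symmetric] by blast
qed

text \<open>The cross term integrates to twice the real part of \<open>l2_inner M r h\<close>, which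
  is 0, so the right side exceeds the left by the squared norm of \<open>h\<close>.\<close>

lemma l2_pythagoras_le:
  assumes r: "square_integrable M r" and h: "square_integrable M h" and "l2_inner M r h = 0"
  shows "(\<integral>y. (cmod (r y))\<^sup>2 \<partial>M) \<le> (\<integral>y. (cmod (r y + h y))\<^sup>2 \<partial>M)"
proof -
  have eq: "(cmod (r y + h y))\<^sup>2 = (cmod (r y))\<^sup>2 + (cmod (h y))\<^sup>2 + 2 * Re (r y * cnj (h y))" for y
    unfolding cmod_power2 by (simp add: power2_eq_square algebra_simps)
  have "(\<integral>y. Re (r y * cnj (h y)) \<partial>M) = 0"
    using assms(3) square_integrable_mult_cnj[OF r h] by (simp add: l2_inner_def del: times_complex.sel)
  moreover have "integrable M (\<lambda>y. Re (r y * cnj (h y)))"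
    by (intro integrable_Re square_integrable_mult_cnj r h)
  ultimately have "(\<integral>y. (cmod (r y + h y))\<^sup>2 \<partial>M)
      = (\<integral>y. (cmod (r y))\<^sup>2 \<partial>M) + (\<integral>y. (cmod (h y))\<^sup>2 \<partial>M)"
    unfolding eq using r h by (simp add: square_integrable_def del: times_complex.sel)
  then show ?thesis
    by (simp add: Bochner_Integration.integral_nonneg)
qed

section \<open>The EDMD loss and its normal equations\<close>

lemma square_integrable_edmd_residual:
  assumes "finite X" "\<And>b. b \<in> X \<Longrightarrow> square_integrable M (\<lambda>y. \<psi> y b)"
    and "square_integrable M (\<lambda>y. \<psi> (\<Phi> y) a)"
  shows "square_integrable M (\<lambda>y. mat_vec X K (\<psi> y) a - \<psi> (\<Phi> y) a)"
  unfolding mat_vec_def using assms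
  by (intro square_integrable_diff square_integrable_sum[where u = "\<lambda>b y. \<psi> y b"])

text \<open>Squaring removes the root in \<open>L2_set\<close>, and the finite sum commutes with the
  integral. The loss thus splits into an independent least-squares problem for each row of
  \<open>K\<close>.\<close>

lemma edmd_loss_eq_sum:
  assumes "finite X" "\<And>a. a \<in> X \<Longrightarrow> square_integrable M (\<lambda>y. \<psi> y a)"
    and "\<And>a. a \<in> X \<Longrightarrow> square_integrable M (\<lambda>y. \<psi> (\<Phi> y) a)"
  shows "edmd_loss M \<Phi> X \<psi> K
    = (\<Sum>a\<in>X. \<integral>y. (cmod (mat_vec X K (\<psi> y) a - \<psi> (\<Phi> y) a))\<^sup>2 \<partial>M)"
proof -
  have "integrable M (\<lambda>y. (cmod (mat_vec X K (\<psi> y) a - \<psi> (\<Phi> y) a))\<^sup>2)" if "a \<in> X" for a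
    using square_integrable_edmd_residual[of X M \<psi> \<Phi> a K] assms that
    by (simp add: square_integrable_def)
  then show ?thesis
    by (simp add: edmd_loss_def vec_norm_def L2_set_def sum_nonneg)
qed

definition normal_equations ::
  "'y measure \<Rightarrow> ('y \<Rightarrow> 'y) \<Rightarrow> 'o set \<Rightarrow> ('y \<Rightarrow> 'o \<Rightarrow> complex) \<Rightarrow> ('o \<Rightarrow> 'o \<Rightarrow> complex) \<Rightarrow> bool" where
  "normal_equations M \<Phi> X \<psi> K \<longleftrightarrow>
     (\<forall>a\<in>X. \<forall>c\<in>X. l2_inner M (\<lambda>y. mat_vec X K (\<psi> y) a - \<psi> (\<Phi> y) a) (\<lambda>y. \<psi> y c) = 0)"

lemma normal_equations_solvable:
  assumes "finite X" "\<And>a. a \<in> X \<Longrightarrow> square_integrable M (\<lambda>y. \<psi> y a)"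
    and "\<And>a. a \<in> X \<Longrightarrow> square_integrable M (\<lambda>y. \<psi> (\<Phi> y) a)"
  shows "\<exists>K. normal_equations M \<Phi> X \<psi> K"
proof -
  have "\<exists>k. \<forall>c\<in>X. l2_inner M (\<lambda>y. (\<Sum>b\<in>X. k b * \<psi> y b) - \<psi> (\<Phi> y) a) (\<lambda>y. \<psi> y c) = 0"
    if "a \<in> X" for a
    using l2_projection_exists[of X M "\<lambda>b y. \<psi> y b"] assms that by blast
  \<comment> \<open>The rows are solved separately; choice assembles them into a matrix.\<close>
  then have "\<exists>K. \<forall>a\<in>X. \<forall>c\<in>X.
      l2_inner M (\<lambda>y. (\<Sum>b\<in>X. K a b * \<psi> y b) - \<psi> (\<Phi> y) a) (\<lambda>y. \<psi> y c) = 0"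
    by (intro bchoice) blast
  then show ?thesis
    by (simp add: normal_equations_def mat_vec_def)
qed

text \<open>Passing from \<open>K\<close> to a competitor \<open>L\<close> changes the residual
  \<open>r\<close> of a row by an element \<open>h\<close> of the span of the \<psi>-components. The
  normal equations make \<open>r\<close> orthogonal to \<open>h\<close>, so Pythagoras gives the
  inequality row by row.\<close>

lemma normal_equations_imp_edmd_matrix:
  assumes "finite X" "\<And>a. a \<in> X \<Longrightarrow> square_integrable M (\<lambda>y. \<psi> y a)"
    and "\<And>a. a \<in> X \<Longrightarrow> square_integrable M (\<lambda>y. \<psi> (\<Phi> y) a)"
    and K: "normal_equations M \<Phi> X \<psi> K"
  shows "edmd_matrix M \<Phi> X \<psi> K"
proof -
  have loss: "edmd_loss M \<Phi> X \<psi> L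
      = (\<Sum>a\<in>X. \<integral>y. (cmod (mat_vec X L (\<psi> y) a - \<psi> (\<Phi> y) a))\<^sup>2 \<partial>M)" for L
    using assms(1-3) by (rule edmd_loss_eq_sum)
  have "edmd_loss M \<Phi> X \<psi> K \<le> edmd_loss M \<Phi> X \<psi> L" for L
    unfolding loss
  proof (rule sum_mono)
    fix a assume a: "a \<in> X"
    define r where "r = (\<lambda>y. mat_vec X K (\<psi> y) a - \<psi> (\<Phi> y) a)"
    define h where "h = (\<lambda>y. \<Sum>b\<in>X. (L a b - K a b) * \<psi> y b)"
    have r: "square_integrable M r"
      unfolding r_def using assms a by (intro square_integrable_edmd_residual) auto
    have h: "square_integrable M h"
      unfolding h_def using assms by (intro square_integrable_sum[where u = "\<lambda>b y. \<psi> y b"]) auto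
    have "l2_inner M r h = 0"
      unfolding h_def using assms r K a
      by (intro l2_inner_sum_right_eq_0[where u = "\<lambda>b y. \<psi> y b"]) (auto simp: normal_equations_def r_def)
    moreover have "r y + h y = mat_vec X L (\<psi> y) a - \<psi> (\<Phi> y) a" for y
      by (simp add: r_def h_def mat_vec_def left_diff_distrib sum_subtractf)
    ultimately have "(\<integral>y. (cmod (r y))\<^sup>2 \<partial>M)
        \<le> (\<integral>y. (cmod (mat_vec X L (\<psi> y) a - \<psi> (\<Phi> y) a))\<^sup>2 \<partial>M)"
      using l2_pythagoras_le[OF r h] by simp
    then show "(\<integral>y. (cmod (mat_vec X K (\<psi> y) a - \<psi> (\<Phi> y) a))\<^sup>2 \<partial>M)
        \<le> (\<integral>y. (cmod (mat_vec X L (\<psi> y) a - \<psi> (\<Phi> y) a))\<^sup>2 \<partial>M)"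
      by (simp add: r_def)
  qed
  then show ?thesis
    by (simp add: edmd_matrix_def is_arg_min_def not_less)
qed

section \<open>Invariance under the group and averaging\<close>

lemma l2_inner_invariant:
  assumes T: "T \<in> M \<rightarrow>\<^sub>M M" "distr M M T = M"
    and "square_integrable M f" "square_integrable M g"
  shows "l2_inner M (\<lambda>y. f (T y)) (\<lambda>y. g (T y)) = l2_inner M f g"
proof -
  have "(\<lambda>y. f y * cnj (g y)) \<in> borel_measurable M"
    using square_integrable_mult_cnj[OF assms(3,4)] by (rule borel_measurable_integrable)
  then have "(\<integral>y. f y * cnj (g y) \<partial>distr M M T) = (\<integral>y. f (T y) * cnj (g (T y)) \<partial>M)"
    using T(1) by (intro integral_distr)
  then show ?thesis
    using T(2) by (simp add: l2_inner_def)
qed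

lemma right_action_bij_betw:
  assumes "group G" "right_action G X \<rho>" "g \<in> carrier G"
  shows "bij_betw (\<lambda>a. \<rho> a g) X X"
proof -
  interpret group G by fact
  have comp: "\<rho> (\<rho> a g) h = \<rho> a (g \<otimes>\<^bsub>G\<^esub> h)" if "a \<in> X" "g \<in> carrier G" "h \<in> carrier G" for a g h
    using assms(2) that by (simp add: right_action_def)
  show ?thesis
    by (rule bij_betwI[where g = "\<lambda>a. \<rho> a (inv\<^bsub>G\<^esub> g)"])
      (use assms in \<open>auto simp: comp right_action_def\<close>)
qed

text \<open>The weight stands inside the sum so that this is literally a combination of the form
  treated in \<open>normal_equations_convex_combination\<close>.\<close>

definition average_matrix ::
  "('g, 'm) monoid_scheme \<Rightarrow> ('o \<Rightarrow> 'g \<Rightarrow> 'o) \<Rightarrow> ('o \<Rightarrow> 'o \<Rightarrow> complex) \<Rightarrow> 'o \<Rightarrow> 'o \<Rightarrow> complex" where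
  "average_matrix G \<rho> K a b
    = (\<Sum>g\<in>carrier G. 1 / of_nat (card (carrier G)) * K (\<rho> a g) (\<rho> b g))"

text \<open>Moving both indices by \<open>h\<close> replaces the summation variable \<open>g\<close>
  by the product of \<open>h\<close> and \<open>g\<close>, and left multiplication by
  \<open>h\<close> permutes the group.\<close>

lemma equivariant_average_matrix:
  assumes "group G" "right_action G X \<rho>"
  shows "equivariant_matrix G X \<rho> (average_matrix G \<rho> K)"
  unfolding equivariant_matrix_def
proof (intro ballI)
  fix h a b assume h: "h \<in> carrier G" and a: "a \<in> X" and b: "b \<in> X"
  interpret group G by fact
  have mult: "\<rho> (\<rho> a h) g = \<rho> a (h \<otimes>\<^bsub>G\<^esub> g)" if "a \<in> X" "g \<in> carrier G" for a g
    using assms(2) that h by (simp add: right_action_def)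
  have "bij_betw (\<lambda>g. h \<otimes>\<^bsub>G\<^esub> g) (carrier G) (carrier G)"
    by (rule bij_betwI[where g = "\<lambda>g. inv\<^bsub>G\<^esub> h \<otimes>\<^bsub>G\<^esub> g"])
      (use h in \<open>auto simp flip: m_assoc\<close>)
  from sum.reindex_bij_betw[OF this, symmetric,
      of "\<lambda>g. 1 / of_nat (card (carrier G)) * K (\<rho> a g) (\<rho> b g)"]
  show "average_matrix G \<rho> K a b = average_matrix G \<rho> K (\<rho> a h) (\<rho> b h)"
    unfolding average_matrix_def by (simp add: mult a b cong: sum.cong)
qed

text \<open>Substituting \<open>T y\<close> for \<open>y\<close>, which preserves inner products,
  turns the equation of the translated matrix at \<open>(a, c)\<close> into that of \<open>K\<close>
  at \<open>(\<rho> a g, \<rho> c g)\<close>. Here \<open>T\<close> stands for the action of the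
  single element \<open>g\<close> on states.\<close>

lemma normal_equations_translate:
  assumes "group G" "right_action G X \<rho>" "finite X" "g \<in> carrier G"
    and \<psi>: "\<And>a. a \<in> X \<Longrightarrow> square_integrable M (\<lambda>y. \<psi> y a)"
    and \<psi>\<Phi>: "\<And>a. a \<in> X \<Longrightarrow> square_integrable M (\<lambda>y. \<psi> (\<Phi> y) a)"
    and \<Phi>: "\<Phi> \<in> space M \<rightarrow> space M"
    and T: "T \<in> M \<rightarrow>\<^sub>M M" "distr M M T = M"
    and \<psi>T: "\<And>a y. a \<in> X \<Longrightarrow> y \<in> space M \<Longrightarrow> \<psi> (T y) a = \<psi> y (\<rho> a g)"
    and \<Phi>T: "\<And>y. y \<in> space M \<Longrightarrow> \<Phi> (T y) = T (\<Phi> y)"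
    and K: "normal_equations M \<Phi> X \<psi> K"
  shows "normal_equations M \<Phi> X \<psi> (\<lambda>a b. K (\<rho> a g) (\<rho> b g))" (is "normal_equations _ _ _ _ ?L")
  unfolding normal_equations_def
proof (intro ballI)
  fix a c assume a: "a \<in> X" and c: "c \<in> X"
  have \<rho>: "\<rho> b g \<in> X" if "b \<in> X" for b
    using assms(2,4) that by (simp add: right_action_def)
  define f where "f = (\<lambda>y. mat_vec X ?L (\<psi> y) a - \<psi> (\<Phi> y) a)"
  have f: "f (T y) = mat_vec X K (\<psi> y) (\<rho> a g) - \<psi> (\<Phi> y) (\<rho> a g)" if y: "y \<in> space M" for y
  proof -
    have "mat_vec X ?L (\<psi> (T y)) a = (\<Sum>b\<in>X. K (\<rho> a g) (\<rho> b g) * \<psi> y (\<rho> b g))"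
      unfolding mat_vec_def using y by (intro sum.cong) (auto simp: \<psi>T)
    \<comment> \<open>Acting by \<open>g\<close> permutes \<open>X\<close>, so
      \<open>\<rho> b g\<close> may be renamed \<open>b\<close>.\<close>
    also have "\<dots> = mat_vec X K (\<psi> y) (\<rho> a g)"
      unfolding mat_vec_def
      using sum.reindex_bij_betw[OF right_action_bij_betw[OF assms(1,2,4)],
          of "\<lambda>b. K (\<rho> a g) b * \<psi> y b"] .
    \<comment> \<open>For the second term, \<open>\<Phi>\<close> commutes with \<open>T\<close>, and
      the relation between \<psi> and \<open>T\<close> is then used at the point
      \<open>\<Phi> y\<close>, which lies in \<open>space M\<close>.\<close>
    finally show ?thesis
      using \<psi>T[OF a, of "\<Phi> y"] \<Phi> y by (auto simp: f_def \<Phi>T)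
  qed
  have "l2_inner M f (\<lambda>y. \<psi> y c) = l2_inner M (\<lambda>y. f (T y)) (\<lambda>y. \<psi> (T y) c)"
    unfolding f_def using assms a c
    by (intro l2_inner_invariant[symmetric] square_integrable_edmd_residual) auto
  also have "\<dots> = l2_inner M (\<lambda>y. mat_vec X K (\<psi> y) (\<rho> a g) - \<psi> (\<Phi> y) (\<rho> a g))
      (\<lambda>y. \<psi> y (\<rho> c g))"
    unfolding l2_inner_def by (intro Bochner_Integration.integral_cong) (auto simp: f \<psi>T c)
  also have "\<dots> = 0"
    using K \<rho> a c by (auto simp: normal_equations_def)
  finally show "l2_inner M f (\<lambda>y. \<psi> y c) = 0" .
qed

text \<open>The residual is affine in the matrix: weights with sum 1 reproduce the inhomogeneous
  term \<open>\<psi> (\<Phi> y) a\<close>, so the residual of the combination is the same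
  combination of residuals. The weights are complex numbers.\<close>

lemma normal_equations_convex_combination:
  assumes "finite X"
    and \<psi>: "\<And>a. a \<in> X \<Longrightarrow> square_integrable M (\<lambda>y. \<psi> y a)"
    and \<psi>\<Phi>: "\<And>a. a \<in> X \<Longrightarrow> square_integrable M (\<lambda>y. \<psi> (\<Phi> y) a)"
    and w: "(\<Sum>i\<in>I. w i) = 1"
    and L: "\<And>i. i \<in> I \<Longrightarrow> normal_equations M \<Phi> X \<psi> (L i)"
  shows "normal_equations M \<Phi> X \<psi> (\<lambda>a b. \<Sum>i\<in>I. w i * L i a b)"
  unfolding normal_equations_def
proof (intro ballI)
  fix a c assume a: "a \<in> X" and c: "c \<in> X"
  define r where "r = (\<lambda>i y. mat_vec X (L i) (\<psi> y) a - \<psi> (\<Phi> y) a)"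
  have "mat_vec X (\<lambda>a b. \<Sum>i\<in>I. w i * L i a b) (\<psi> y) a - \<psi> (\<Phi> y) a = (\<Sum>i\<in>I. w i * r i y)" for y
  proof -
    have "mat_vec X (\<lambda>a b. \<Sum>i\<in>I. w i * L i a b) (\<psi> y) a
        = (\<Sum>i\<in>I. w i * mat_vec X (L i) (\<psi> y) a)"
      unfolding mat_vec_def sum_distrib_left sum_distrib_right
      by (subst sum.swap) (simp add: mult.assoc)
    moreover have "(\<Sum>i\<in>I. w i * \<psi> (\<Phi> y) a) = \<psi> (\<Phi> y) a"
      using w by (simp flip: sum_distrib_right)
    ultimately show ?thesis
      by (simp add: r_def right_diff_distrib sum_subtractf)
  qed
  moreover have "l2_inner M (\<lambda>y. \<Sum>i\<in>I. w i * r i y) (\<lambda>y. \<psi> y c)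
      = (\<Sum>i\<in>I. w i * l2_inner M (r i) (\<lambda>y. \<psi> y c))"
    unfolding r_def using assms a c
    by (intro l2_inner_sum_left square_integrable_edmd_residual) auto
  moreover have "l2_inner M (r i) (\<lambda>y. \<psi> y c) = 0" if "i \<in> I" for i
    using L[OF that] a c by (simp add: normal_equations_def r_def)
  ultimately show "l2_inner M (\<lambda>y. mat_vec X (\<lambda>a b. \<Sum>i\<in>I. w i * L i a b) (\<psi> y) a - \<psi> (\<Phi> y) a)
      (\<lambda>y. \<psi> y c) = 0"
    by simp
qed

theorem theorem3p1:
  fixes P :: "'y measure"
    and \<Phi> :: "'y \<Rightarrow> 'y"
    and G :: "('g, 'm) monoid_scheme"
    and \<phi> :: "'g \<Rightarrow> 'y \<Rightarrow> 'y"
    and Obs :: "'o set"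
    and \<rho> :: "'o \<Rightarrow> 'g \<Rightarrow> 'o"
    and \<psi> :: "'y \<Rightarrow> 'o \<Rightarrow> complex"
  assumes "prob_space P"
    and "\<Phi> \<in> space P \<rightarrow> space P"
    and "group G" and "finite (carrier G)"
    and "finite Obs"
    and "\<And>a. a \<in> Obs \<Longrightarrow> square_integrable P (\<lambda>y. \<psi> y a)"
    and "\<And>a. a \<in> Obs \<Longrightarrow> square_integrable P (\<lambda>y. \<psi> (\<Phi> y) a)"
    and A1_left: "group_action G (space P) \<phi>"
    and A1_right: "free_right_action G Obs \<rho>"
    and A2: "\<And>g a y. g \<in> carrier G \<Longrightarrow> a \<in> Obs \<Longrightarrow> y \<in> space P \<Longrightarrow> \<psi> (\<phi> g y) a = \<psi> y (\<rho> a g)"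
    and A3: "\<And>g y. g \<in> carrier G \<Longrightarrow> y \<in> space P \<Longrightarrow> \<Phi> (\<phi> g y) = \<phi> g (\<Phi> y)"
    and A4_measurable: "\<And>g. g \<in> carrier G \<Longrightarrow> \<phi> g \<in> P \<rightarrow>\<^sub>M P"
    and A4: "\<And>g. g \<in> carrier G \<Longrightarrow> distr P P (\<phi> g) = P"
  shows "\<exists>K. edmd_matrix P \<Phi> Obs \<psi> K \<and> equivariant_matrix G Obs \<rho> K"
proof -
  interpret group G by fact
  have right: "right_action G Obs \<rho>"
    using A1_right by (simp add: free_right_action_def)
  \<comment> \<open>This solution need not be equivariant; its translates by the group are averaged
    below.\<close>
  obtain K where K: "normal_equations P \<Phi> Obs \<psi> K"
    using normal_equations_solvable[of Obs P \<psi> \<Phi>] assms(5-7) by blast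
  have "normal_equations P \<Phi> Obs \<psi> (\<lambda>a b. K (\<rho> a g) (\<rho> b g))" if "g \<in> carrier G" for g
    by (rule normal_equations_translate[where T = "\<phi> g" and G = G])
      (use assms(2-7) right that A2 A3 A4 A4_measurable K in auto)
  \<comment> \<open>The carrier is finite and contains the identity, so its cardinality is nonzero
    and the uniform weights sum to 1.\<close>
  moreover have "(\<Sum>g\<in>carrier G. 1 / of_nat (card (carrier G))) = (1::complex)"
    using assms(4) one_closed by (auto simp: card_eq_0_iff)
  ultimately have "normal_equations P \<Phi> Obs \<psi> (average_matrix G \<rho> K)"
    using normal_equations_convex_combination[where I = "carrier G"
        and w = "\<lambda>_. 1 / of_nat (card (carrier G))" and L = "\<lambda>g a b. K (\<rho> a g) (\<rho> b g)"
        and M = P and X = Obs and \<psi> = \<psi> and \<Phi> = \<Phi>] assms(5-7)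
    by (simp add: average_matrix_def[abs_def])
  then have "edmd_matrix P \<Phi> Obs \<psi> (average_matrix G \<rho> K)"
    using assms(5-7) by (intro normal_equations_imp_edmd_matrix) auto
  moreover have "equivariant_matrix G Obs \<rho> (average_matrix G \<rho> K)"
    using assms(3) right by (rule equivariant_average_matrix)
  ultimately show ?thesis by blast
qed

end
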